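(* Let $\langle M,P(u)\rangle$ be a probabilistic causal model with $M=\langle V,U,F\rangle$, let $X,Y\in V$ be distinct endogenous variables, let $x$ be a value of $X$, let $Y_x$ be the counterfactual variable for $Y$ under the intervention $do(X=x)$, and let $\mathcal{W}_m$ be the cross-world SCM graph for $do(X=x)$ (as defined in the context). Let $E$ be a set of real-world endogenous variables, with $e$ the observed value of $E$ (the evidence), and let $Z$ be a set of observable (real-world endogenous) variables. Suppose that $X$ and $Y_x$ are $d$-separated by $E\cup Z$ in $\mathcal{W}_m$. Then $Y_x$ is conditionally independent of $X$ given $\{E,Z\}$, i.e. $X \perp\!\!\!\perp Y_x \mid \{E,Z\}$, and for every value $y$ of $Y$ the following cross-world adjustment formula holds: $$P(Y_x=y\mid E=e)=\sum_{z}P(Y=y\mid Z=z,\,X=x,\,E=e)\,P(Z=z\mid E=e),$$ where the sum ranges over the values $z$ of $Z$ with $P(Z=z\mid E=e)>0$.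
   Context: **Model.** A structural causal model (SCM) is a triple $M=\langle V,U,F\rangle$, where $V=\{V_1,\dots,V_n\}$ is the set of endogenous variables, $U=\{U_1,\dots,U_n\}$ is the set of exogenous variables, and $F=\{f_1,\dots,f_n\}$ is the set of structural equations $v_i=f_i(pa_i,u_i)$, with $PA_i\subseteq V\setminus\{V_i\}$ the parents of $V_i$ and $U_i$ the exogenous variable of $V_i$. The directed graph on $V\cup U$ with an edge into $V_i$ from each element of $PA_i\cup\{U_i\}$ is acyclic; exogenous variables have no parents. A probabilistic causal model $\langle M,P(u)\rangle$ adds a probability distribution $P(u)$ on the values of $U$. All variables are discrete with finitely many values, and $U_1,\dots,U_n$ are mutually independent (so $P(v_1,\dots,v_n)=\prod_i P(v_i\mid pa_i)$). Each endogenous variable is a function of $u$, obtained by solving the structural equations recursively. **Counterfactuals.** For an endogenous variable $X=V_i$ and a value $x$ of it, $M_x=\langle V,U,F_x\rangle$ is obtained from $M$ by replacing the equation for $X$ by the constant equation $X=x$. For an endogenous variable $D$, $D_x(u)$ denotes the solution for $D$ in $M_x$ at $U=u$. All real-world variables $D(u)$ and counterfactual variables $D_x(u)$ are random variables on the same probability space of values $u$ with distribution $P(u)$; for example, $P(Y_x=y,X=x')=\sum_{\{u:\,Y_x(u)=y,\ X(u)=x'\}}P(u)$. **Cross-world SCM $\mathcal{W}_m$ for $do(X=x)$.** The real world is $\mathcal{W}_r=\langle M,u\rangle$ and the counterfactual world is $\mathcal{W}_c=\langle M_x,u\rangle$, sharing the same $u$. A *teleporter* is a variable that is $d$-separated from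 $X=x$ (by the empty set) in the graph of $M_x$. The endogenous teleporters are exactly the endogenous variables other than $X$ that are not descendants of $X$; they have the same structural equations and values in both worlds. The directed acyclic graph $\mathcal{W}_m$ is built as follows. - Nodes: all real-world endogenous variables $V$; the constant node $x$; a node $D_x$ for each proper descendant $D$ of $X$ in $M$; and the exogenous variables of all endogenous variables that are not teleporters. The exogenous variables of the endogenous teleporters are removed. - Edges among real-world nodes (including retained exogenous nodes) are those of the graph of $M$. - Each node $D_x$ receives edges from: the exogenous variable of $D$ (shared with $D$); each parent of $D$ that is an endogenous teleporter (the teleporter is a single node shared by both worlds); the node $B_x$ for each parent $B$ of $D$ that is a proper descendant of $X$; and the constant node $x$ if $X$ is a parent of $D$. - The node $x$ has no incoming edges. If $Y$ is not a descendant of $X$, then $Y_x$ is identified with the shared node $Y$. **$d$-separation.** A path is blocked by a set of nodes $S$ if and only if it contains a chain $A\to B\to C$ (or $A\leftarrow B\leftarrow C$) or a fork $A\leftarrow B\to C$ with $B\in S$, or a collider $A\to B\leftarrow C$ such that neither $B$ nor any descendant of $B$ is in $S$. Two nodes are $d$-separated by $S$ if neither belongs to $S$ and $S$ blocks every path between them. **Convention.** The conditional probabilities in the formula are assumed to be well defined: $P(E=e)>0$, and $P(Z=z,X=x,E=e)>0$ for every $z$ with $P(Z=z,E=e)>0$. *)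

theory Defs
  imports "HOL-Probability.Probability"
begin

section \<open>Directed graphs and d-separation\<close>

record 'n digraph =
  nodes :: "'n set"
  edges :: "('n \<times> 'n) set"

text \<open>Paths ignore the direction of edges. The one-node path is a path, so no node is
  d-separated from itself.\<close>

definition is_path :: "'n digraph \<Rightarrow> 'n \<Rightarrow> 'n list \<Rightarrow> 'n \<Rightarrow> bool" where
  "is_path G a p b \<longleftrightarrow>
     p \<noteq> [] \<and> hd p = a \<and> last p = b \<and> distinct p \<and> set p \<subseteq> nodes G \<and>
     (\<forall>i. Suc i < length p \<longrightarrow>
        (p ! i, p ! Suc i) \<in> edges G \<or> (p ! Suc i, p ! i) \<in> edges G)"

definition chain :: "'n digraph \<Rightarrow> 'n \<Rightarrow> 'n \<Rightarrow> 'n \<Rightarrow> bool" where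
  "chain G a b c \<longleftrightarrow> (a, b) \<in> edges G \<and> (b, c) \<in> edges G"

definition fork :: "'n digraph \<Rightarrow> 'n \<Rightarrow> 'n \<Rightarrow> 'n \<Rightarrow> bool" where
  "fork G a b c \<longleftrightarrow> (b, a) \<in> edges G \<and> (b, c) \<in> edges G"

definition collider :: "'n digraph \<Rightarrow> 'n \<Rightarrow> 'n \<Rightarrow> 'n \<Rightarrow> bool" where
  "collider G a b c \<longleftrightarrow> (a, b) \<in> edges G \<and> (c, b) \<in> edges G"

definition blocks :: "'n digraph \<Rightarrow> 'n set \<Rightarrow> 'n list \<Rightarrow> bool" where
  "blocks G S p \<longleftrightarrow>
     (\<exists>i. i + 2 < length p \<and>
        (let a = p ! i; b = p ! (i + 1); c = p ! (i + 2) in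
           ((chain G a b c \<or> chain G c b a \<or> fork G a b c) \<and> b \<in> S) \<or>
           (collider G a b c \<and> (\<forall>s\<in>S. (b, s) \<notin> (edges G)\<^sup>*))))"

definition d_separated :: "'n digraph \<Rightarrow> 'n set \<Rightarrow> 'n \<Rightarrow> 'n \<Rightarrow> bool" where
  "d_separated G S a b \<longleftrightarrow>
     a \<notin> S \<and> b \<notin> S \<and> (\<forall>p. is_path G a p b \<longrightarrow> blocks G S p)"

section \<open>Structural causal models\<close>

text \<open>The exogenous variable of the endogenous variable \<open>i\<close> carries the same index \<open>i\<close>.
  All endogenous variables take their values in one type \<open>'a\<close> and all exogenous ones in one
  type \<open>'u\<close>; the ranges of the individual variables are \<open>val M i\<close> and \<open>exo_val M i\<close>.
  The structural function of \<open>i\<close> is applied to an assignment of the parents of \<open>i\<close>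
  and to the value of the exogenous variable of \<open>i\<close>.\<close>

record ('v, 'a, 'u) scm =
  endo :: "'v set"
  val :: "'v \<Rightarrow> 'a set"
  exo_val :: "'v \<Rightarrow> 'u set"
  parents :: "'v \<Rightarrow> 'v set"
  eqn :: "'v \<Rightarrow> ('v \<Rightarrow> 'a) \<Rightarrow> 'u \<Rightarrow> 'a"

text \<open>\<open>Real\<close> and \<open>Exo\<close> are the endogenous and exogenous nodes of the graph of a model.
  \<open>Const\<close> (the constant node \<open>x\<close>) and \<open>Cf D\<close> (the node \<open>D\<^sub>x\<close>) occur in the cross-world
  graph only.\<close>

datatype 'v node = Real 'v | Exo 'v | Const | Cf 'v

definition scm_graph :: "('v, 'a, 'u) scm \<Rightarrow> 'v node digraph" where
  "scm_graph M =
     \<lparr>nodes = Real ` endo M \<union> Exo ` endo M,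
      edges = {(Real j, Real i) | i j. i \<in> endo M \<and> j \<in> parents M i} \<union>
              {(Exo i, Real i) | i. i \<in> endo M}\<rparr>"

locale causal_model =
  fixes M :: "('v, 'a, 'u) scm"
  assumes finite_endo: "finite (endo M)"
    and finite_val: "i \<in> endo M \<Longrightarrow> finite (val M i)"
    and finite_exo_val: "i \<in> endo M \<Longrightarrow> finite (exo_val M i)"
    and parents_subset: "i \<in> endo M \<Longrightarrow> parents M i \<subseteq> endo M - {i}"
    and eqn_val: "i \<in> endo M \<Longrightarrow> pa \<in> PiE (parents M i) (val M) \<Longrightarrow> u \<in> exo_val M i \<Longrightarrow>
                    eqn M i pa u \<in> val M i"
    and acyclic_graph: "acyclic (edges (scm_graph M))"

locale probabilistic_causal_model = causal_model M
  for M :: "('v, 'a, 'u) scm" +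
  fixes P :: "('v \<Rightarrow> 'u) pmf"
  assumes support: "set_pmf P \<subseteq> PiE (endo M) (exo_val M)"
    and indep_exo: "prob_space.indep_vars (measure_pmf P)
                      (\<lambda>_. count_space UNIV) (\<lambda>i u. u i) (endo M)"

definition solves :: "('v, 'a, 'u) scm \<Rightarrow> ('v \<Rightarrow> 'u) \<Rightarrow> ('v \<Rightarrow> 'a) \<Rightarrow> bool" where
  "solves M u v \<longleftrightarrow>
     v \<in> extensional (endo M) \<and>
     (\<forall>i\<in>endo M. v i = eqn M i (restrict v (parents M i)) (u i))"

definition solution :: "('v, 'a, 'u) scm \<Rightarrow> ('v \<Rightarrow> 'u) \<Rightarrow> ('v \<Rightarrow> 'a)" where
  "solution M u = (THE v. solves M u v)"

definition intervene :: "('v, 'a, 'u) scm \<Rightarrow> 'v \<Rightarrow> 'a \<Rightarrow> ('v, 'a, 'u) scm" where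
  "intervene M X x =
     M\<lparr>parents := (parents M)(X := {}), eqn := (eqn M)(X := (\<lambda>_ _. x))\<rparr>"

lemma (in causal_model) wf_parents: "wf {(j, i). i \<in> endo M \<and> j \<in> parents M i}"
proof -
  have "edges (scm_graph M) \<subseteq> nodes (scm_graph M) \<times> nodes (scm_graph M)"
    using parents_subset by (auto simp: scm_graph_def)
  moreover have "finite (nodes (scm_graph M))"
    using finite_endo by (simp add: scm_graph_def)
  ultimately have "finite (edges (scm_graph M))"
    by (meson finite_SigmaI finite_subset)
  then have "wf (inv_image (edges (scm_graph M)) Real)"
    using acyclic_graph by (intro wf_inv_image finite_acyclic_wf)
  then show ?thesis
    by (rule wf_subset) (auto simp: scm_graph_def inv_image_def)
qed

lemma (in causal_model) ex1_solves: "\<exists>!v. solves M u v"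
proof -
  define R where "R = {(j, i). i \<in> endo M \<and> j \<in> parents M i}"
  have wf: "wf R" unfolding R_def by (rule wf_parents)
  define H where
    "H = (\<lambda>h i. if i \<in> endo M then eqn M i (restrict h (parents M i)) (u i) else undefined)"
  define v where "v = wfrec R H"
  have v: "v i = H (cut v R i) i" for i
    unfolding v_def by (rule wfrec[OF wf])
  have cut: "restrict (cut v R i) (parents M i) = restrict v (parents M i)" if "i \<in> endo M" for i
    using that by (auto simp: restrict_def cut_def R_def)
  have "solves M u v"
    unfolding solves_def
  proof (intro conjI ballI)
    show "v \<in> extensional (endo M)"
      unfolding extensional_def using v by (simp add: H_def)
    show "v i = eqn M i (restrict v (parents M i)) (u i)" if "i \<in> endo M" for i
      using v[of i] cut[OF that] that by (simp add: H_def)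
  qed
  moreover have "w = w'" if w: "solves M u w" and w': "solves M u w'" for w w'
  proof
    fix i
    show "w i = w' i"
      using wf
    proof (induction i rule: wf_induct_rule)
      case (less i)
      show ?case
      proof (cases "i \<in> endo M")
        case True
        have "restrict w (parents M i) = restrict w' (parents M i)"
          using less True by (auto simp: restrict_def R_def)
        then show ?thesis
          using w w' True by (simp add: solves_def)
      next
        case False
        then show ?thesis
          using w w' by (auto simp: solves_def extensional_def)
      qed
    qed
  qed
  ultimately show ?thesis by blast
qed

lemma (in causal_model) causal_model_intervene:
  assumes "x \<in> val M X"
  shows "causal_model (intervene M X x)"
proof
  have "edges (scm_graph (intervene M X x)) \<subseteq> edges (scm_graph M)"
    by (auto simp: scm_graph_def intervene_def split: if_splits)
  then show "acyclic (edges (scm_graph (intervene M X x)))"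
    using acyclic_graph acyclic_subset by blast
next
  fix i pa u
  assume "i \<in> endo (intervene M X x)"
    and "pa \<in> PiE (parents (intervene M X x) i) (val (intervene M X x))"
    and "u \<in> exo_val (intervene M X x) i"
  then show "eqn (intervene M X x) i pa u \<in> val (intervene M X x) i"
    using assms eqn_val by (cases "i = X") (auto simp: intervene_def)
next
  fix i assume "i \<in> endo (intervene M X x)"
  then show "parents (intervene M X x) i \<subseteq> endo (intervene M X x) - {i}"
    using parents_subset by (auto simp: intervene_def split: if_splits)
qed (use finite_endo finite_val finite_exo_val in \<open>auto simp: intervene_def\<close>)

section \<open>The cross-world graph\<close>

text \<open>The graph of \<open>M\<^sub>x\<close>, in which \<open>Real X\<close> is the constant \<open>x\<close> and has no incoming edge,
  not even from its exogenous variable.\<close>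

definition intervened_graph :: "('v, 'a, 'u) scm \<Rightarrow> 'v \<Rightarrow> 'v node digraph" where
  "intervened_graph M X =
     (scm_graph M)\<lparr>edges := {(a, b) \<in> edges (scm_graph M). b \<noteq> Real X}\<rparr>"

definition teleporters :: "('v, 'a, 'u) scm \<Rightarrow> 'v \<Rightarrow> 'v node set" where
  "teleporters M X =
     {T \<in> nodes (intervened_graph M X). d_separated (intervened_graph M X) {} T (Real X)}"

definition proper_desc :: "('v, 'a, 'u) scm \<Rightarrow> 'v \<Rightarrow> 'v set" where
  "proper_desc M X = {D \<in> endo M. (Real X, Real D) \<in> (edges (scm_graph M))\<^sup>+}"

text \<open>The endogenous teleporters are exactly the endogenous non-descendants of \<open>X\<close>.\<close>

lemma (in causal_model) endo_teleporter_iff: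
  assumes "T \<in> endo M" "X \<in> endo M"
  shows "Real T \<in> teleporters M X \<longleftrightarrow> T \<noteq> X \<and> T \<notin> proper_desc M X"
proof -
  define G where "G = intervened_graph M X"
  have sub: "edges G \<subseteq> edges (scm_graph M)"
    by (auto simp: G_def intervened_graph_def)
  have nodesG: "edges G \<subseteq> nodes G \<times> nodes G"
    using parents_subset by (auto simp: G_def intervened_graph_def scm_graph_def)
  have acG: "acyclic (edges G)"
    using sub acyclic_graph acyclic_subset by blast
  have noX: "(a, Real X) \<notin> edges G" for a
    by (simp add: G_def intervened_graph_def)
  have XG: "Real X \<in> nodes G" and TG: "Real T \<in> nodes G"
    using assms by (auto simp: G_def intervened_graph_def scm_graph_def)
  have reach: "(Real X, b) \<in> (edges G)\<^sup>*" if "(Real X, b) \<in> (edges (scm_graph M))\<^sup>*" for b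
    using that
  proof (induction rule: rtrancl_induct)
    case (step b c)
    have "c \<noteq> Real X"
      using step.hyps acyclic_graph by (metis acyclic_def rtrancl_into_trancl1)
    then have "(b, c) \<in> edges G"
      using step.hyps by (simp add: G_def intervened_graph_def)
    then show ?case using step.IH by (rule rtrancl_into_rtrancl[rotated])
  qed simp
  have open_path: "\<exists>p. is_path G b p (Real X) \<and> \<not> blocks G {} p"
    if "(Real X, b) \<in> (edges G)\<^sup>*" for b
  proof -
    have "\<exists>p. is_path G b p (Real X) \<and> (\<forall>c\<in>set p. (c, b) \<in> (edges G)\<^sup>*) \<and>
              (\<forall>i. Suc i < length p \<longrightarrow> (p ! Suc i, p ! i) \<in> edges G)"
      using that
    proof (induction rule: rtrancl_induct)
      case base
      show ?case using XG by (intro exI[of _ "[Real X]"]) (simp add: is_path_def)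
    next
      case (step b c)
      then obtain p where p: "is_path G b p (Real X)" "\<forall>d\<in>set p. (d, b) \<in> (edges G)\<^sup>*"
          "\<forall>i. Suc i < length p \<longrightarrow> (p ! Suc i, p ! i) \<in> edges G"
        by blast
      have "c \<notin> set p"
        using p(2) step.hyps(2) acG by (metis acyclic_def rtrancl_into_trancl1)
      moreover have dir: "((c # p) ! Suc i, (c # p) ! i) \<in> edges G" if "Suc i < length (c # p)" for i
        using p that step.hyps(2) by (cases i) (auto simp: is_path_def hd_conv_nth)
      ultimately show ?case
        using p step.hyps(2) nodesG
        by (intro exI[of _ "c # p"])
          (auto simp: is_path_def simp del: nth_Cons_Suc intro: rtrancl_into_rtrancl)
    qed
    then obtain p where p: "is_path G b p (Real X)"
        "\<And>i. Suc i < length p \<Longrightarrow> (p ! Suc i, p ! i) \<in> edges G"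
      by blast
    have "\<not> collider G (p ! i) (p ! (i + 1)) (p ! (i + 2))" if "i + 2 < length p" for i
      using p(2)[of i] that acG unfolding collider_def acyclic_def
      by (metis Suc_1 Suc_lessD add_Suc_right Suc_eq_plus1 trancl.r_into_trancl trancl_into_trancl)
    then show ?thesis
      using p(1) by (auto simp: blocks_def Let_def)
  qed
  have directed: "(Real X, b) \<in> (edges G)\<^sup>*"
    if p: "is_path G b p (Real X)" and nb: "\<not> blocks G {} p" for b p
  proof -
    have dir: "(p ! Suc i, p ! i) \<in> edges G" if "Suc i < length p" for i
      using that
    proof (induction "length p - i" arbitrary: i rule: less_induct)
      case less
      have adj: "(p ! i, p ! Suc i) \<in> edges G \<or> (p ! Suc i, p ! i) \<in> edges G"
        using p less.prems by (simp add: is_path_def)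
      show ?case
      proof (cases "Suc (Suc i) < length p")
        case True
        then have "(p ! Suc (Suc i), p ! Suc i) \<in> edges G"
          by (intro less.hyps) auto
        then show ?thesis
          using nb True adj by (auto simp: blocks_def Let_def collider_def)
      next
        case False
        then have "length p = Suc (Suc i)"
          using less.prems by simp
        then have "p ! Suc i = Real X"
          using p by (auto simp: is_path_def last_conv_nth)
        then show ?thesis using adj noX by simp
      qed
    qed
    have "(last p, p ! i) \<in> (edges G)\<^sup>*" if "i < length p" for i
      using that
    proof (induction "length p - i" arbitrary: i rule: less_induct)
      case less
      show ?case
      proof (cases "Suc i < length p")
        case True
        then have "(last p, p ! Suc i) \<in> (edges G)\<^sup>*"
          by (intro less.hyps) auto
        then show ?thesis
          using dir[OF True] by (rule rtrancl_into_rtrancl)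
      next
        case False
        then have "i = length p - 1" using less.prems by simp
        then have "p ! i = last p" using p by (metis is_path_def last_conv_nth)
        then show ?thesis by simp
      qed
    qed
    from this[of 0] show ?thesis
      using p by (metis is_path_def hd_conv_nth length_greater_0_conv)
  qed
  have "Real T \<in> teleporters M X \<longleftrightarrow> (Real X, Real T) \<notin> (edges G)\<^sup>*"
    using TG open_path directed unfolding teleporters_def d_separated_def G_def by blast
  also have "\<dots> \<longleftrightarrow> (Real X, Real T) \<notin> (edges (scm_graph M))\<^sup>*"
    using reach rtrancl_mono[OF sub] by blast
  also have "\<dots> \<longleftrightarrow> T \<noteq> X \<and> T \<notin> proper_desc M X"
    using assms by (auto simp: proper_desc_def rtrancl_eq_or_trancl)
  finally show ?thesis .
qed

definition real_world_nodes :: "('v, 'a, 'u) scm \<Rightarrow> 'v \<Rightarrow> 'v node set" where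
  "real_world_nodes M X =
     Real ` endo M \<union> Exo ` {i \<in> endo M. Real i \<notin> teleporters M X}"

definition cross_world_graph :: "('v, 'a, 'u) scm \<Rightarrow> 'v \<Rightarrow> 'v node digraph" where
  "cross_world_graph M X =
     \<lparr>nodes = real_world_nodes M X \<union> {Const} \<union> Cf ` proper_desc M X,
      edges =
        {(a, b) \<in> edges (scm_graph M). a \<in> real_world_nodes M X \<and> b \<in> real_world_nodes M X} \<union>
        {(Exo D, Cf D) | D. D \<in> proper_desc M X} \<union>
        {(Real B, Cf D) | B D. D \<in> proper_desc M X \<and> B \<in> parents M D \<and>
                               Real B \<in> teleporters M X} \<union>
        {(Cf B, Cf D) | B D. D \<in> proper_desc M X \<and> B \<in> parents M D \<and>
                             B \<in> proper_desc M X} \<union>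
        {(Const, Cf D) | D. D \<in> proper_desc M X \<and> X \<in> parents M D}\<rparr>"

definition cf_node :: "('v, 'a, 'u) scm \<Rightarrow> 'v \<Rightarrow> 'v \<Rightarrow> 'v node" where
  "cf_node M X Y = (if Y \<in> proper_desc M X then Cf Y else Real Y)"

section \<open>Conditional independence of discrete random variables\<close>

definition cond_indep ::
    "'w pmf \<Rightarrow> ('w \<Rightarrow> 'a) \<Rightarrow> ('w \<Rightarrow> 'b) \<Rightarrow> ('w \<Rightarrow> 'c) \<Rightarrow> bool" where
  "cond_indep p A B C \<longleftrightarrow>
     (\<forall>a b c. \<P>(w in measure_pmf p. C w = c) > 0 \<longrightarrow>
        \<P>(w in measure_pmf p. A w = a \<and> B w = b \<bar> C w = c) =
        \<P>(w in measure_pmf p. A w = a \<bar> C w = c) * \<P>(w in measure_pmf p. B w = b \<bar> C w = c))"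

section \<open>Counterfactual and set-valued observations\<close>

definition counterfactual :: "('v, 'a, 'u) scm \<Rightarrow> 'v \<Rightarrow> 'a \<Rightarrow> 'v \<Rightarrow> ('v \<Rightarrow> 'u) \<Rightarrow> 'a" where
  "counterfactual M X x D u = solution (intervene M X x) u D"

definition obs :: "('v, 'a, 'u) scm \<Rightarrow> 'v set \<Rightarrow> ('v \<Rightarrow> 'u) \<Rightarrow> ('v \<Rightarrow> 'a)" where
  "obs M A u = restrict (solution M u) A"

end

theory Submission
  imports Defs "HOL-Probability.Product_PMF"
begin

text \<open>
  Independence is obtained by splicing noise instead of factorizing the joint distribution.
  Let \<open>R\<close> be the set of nodes, outside \<open>E \<union> Z\<close>, which are ancestors of \<open>X\<close>, \<open>Y\<^sub>x\<close> or
  \<open>E \<union> Z\<close> and have an open walk to \<open>Y\<^sub>x\<close>. For every such ancestor, the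
  members of its family (itself and its parents) outside \<open>E \<union> Z\<close> are all in \<open>R\<close> or all
  outside \<open>R\<close>. So if \<open>u\<close> and \<open>u'\<close> agree on \<open>E \<union> Z\<close>, then the
  noise that equals \<open>u\<close> on \<open>R\<close> and \<open>u'\<close> elsewhere still produces the same \<open>E \<union> Z\<close>, the
  \<open>Y\<^sub>x\<close> of \<open>u\<close>, and (as \<open>X \<notin> R\<close> by d-separation) the \<open>X\<close> of \<open>u'\<close>. Exchanging the coordinates in
  \<open>R\<close> preserves the law of two independent copies of the noise, whence
  \<open>P(X, Y\<^sub>x, c) P(c) = P(X, c) P(Y\<^sub>x, c)\<close>. The adjustment formula follows by total probability and
  consistency (\<open>Y\<^sub>x = Y\<close> where \<open>X = x\<close>).
\<close>

section \<open>Open walks\<close>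

text \<open>For neighbours \<open>a\<close> and \<open>c\<close> of \<open>b\<close> in an acyclic
  graph, the else branch covers exactly the chains and forks, so this negates the condition of
  \<open>blocks\<close> at \<open>b\<close>. The case \<open>a = c\<close> is allowed.\<close>

definition open_at :: "('n \<times> 'n) set \<Rightarrow> 'n set \<Rightarrow> 'n \<Rightarrow> 'n \<Rightarrow> 'n \<Rightarrow> bool" where
  "open_at D S a b c \<longleftrightarrow>
     (if (a, b) \<in> D \<and> (c, b) \<in> D then \<exists>s\<in>S. (b, s) \<in> D\<^sup>* else b \<notin> S)"

text \<open>Nodes may repeat and the two ends are not tested against \<open>S\<close>, so extending
  a walk at its head requires checking only one new triple.\<close>

fun open_walk :: "('n \<times> 'n) set \<Rightarrow> 'n set \<Rightarrow> 'n list \<Rightarrow> bool" where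
  "open_walk D S [] \<longleftrightarrow> False"
| "open_walk D S [a] \<longleftrightarrow> True"
| "open_walk D S (a # b # p) \<longleftrightarrow>
     ((a, b) \<in> D \<or> (b, a) \<in> D) \<and> (p \<noteq> [] \<longrightarrow> open_at D S a b (hd p)) \<and> open_walk D S (b # p)"

lemma open_walk_append:
  "open_walk D S (xs @ v # zs) \<longleftrightarrow>
     open_walk D S (xs @ [v]) \<and> open_walk D S (v # zs) \<and>
     (xs \<noteq> [] \<and> zs \<noteq> [] \<longrightarrow> open_at D S (last xs) v (hd zs))"
proof (induction xs)
  case Nil
  then show ?case by simp
next
  case (Cons a xs)
  then show ?case
  proof (cases xs)
    case Nil
    then show ?thesis by auto
  next
    case (Cons b xs')
    then show ?thesis using Cons.IH by (cases xs') auto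
  qed
qed

text \<open>A walk that leaves \<open>v\<close> forwards and ends with a reversed edge has a first collider; it is a
  descendant of \<open>v\<close>, and being open it has a descendant in \<open>S\<close>.\<close>

lemma open_walk_turns:
  assumes "acyclic D" "open_walk D S (v # c # r)" "(v, c) \<in> D"
    and "(last (v # c # r), last (butlast (v # c # r))) \<in> D"
  shows "\<exists>s\<in>S. (v, s) \<in> D\<^sup>*"
  using assms(2-)
proof (induction r arbitrary: v c)
  case Nil
  then have "(v, v) \<in> D\<^sup>+" by auto
  then show ?case using \<open>acyclic D\<close> by (auto simp: acyclic_def)
next
  case (Cons c' r)
  have "\<exists>s\<in>S. (c, s) \<in> D\<^sup>*"
  proof (cases "(c', c) \<in> D")
    case True
    then show ?thesis using Cons.prems by (auto simp: open_at_def)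
  next
    case False
    then show ?thesis using Cons.prems by (intro Cons.IH[of c c']) auto
  qed
  then show ?case using Cons.prems(2) by (meson converse_rtrancl_into_rtrancl)
qed

text \<open>Only the triple at \<open>v\<close> can be new. If it is no collider, then one of the
  two old triples at \<open>v\<close> is none either, so \<open>v\<close> is outside
  \<open>S\<close>. If it is a collider, then either an old triple at \<open>v\<close> was an open
  collider, or both end edges of the loop point away from \<open>v\<close> and
  \<open>open_walk_turns\<close> gives the descendant in \<open>S\<close>.\<close>

lemma open_walk_cut_loop:
  assumes ac: "acyclic D" and w: "open_walk D S (xs @ v # ys @ v # zs)"
  shows "open_walk D S (xs @ v # zs)"
proof -
  have 1: "open_walk D S (xs @ [v])" "open_walk D S (v # ys @ v # zs)"
    and o1: "xs \<noteq> [] \<Longrightarrow> open_at D S (last xs) v (hd (ys @ [v]))"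
    using w open_walk_append[of D S xs v "ys @ v # zs"] by (auto simp: hd_append split: if_splits)
  have 2: "open_walk D S (v # ys @ [v])" "open_walk D S (v # zs)"
    and o2: "zs \<noteq> [] \<Longrightarrow> open_at D S (last (v # ys)) v (hd zs)"
    using 1(2) open_walk_append[of D S "v # ys" v zs] by auto
  have nl: "(c, v) \<notin> D" if "(v, c) \<in> D" for c
    using that ac by (meson acyclic_def trancl.intros)
  then have "ys \<noteq> []" using 2(1) nl[of v] by auto
  then obtain c ys' where ys: "ys = c # ys'" by (cases ys) auto
  have adj: "(v, c) \<in> D \<or> (c, v) \<in> D" using 2(1) ys by simp
  have adj': "(last ys, v) \<in> D \<or> (v, last ys) \<in> D"
    using 2(1) open_walk_append[of D S "v # butlast ys" "last ys" "[v]"]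
      append_butlast_last_id[OF \<open>ys \<noteq> []\<close>]
    by (metis append.assoc append_Cons append_Nil open_walk.simps(3))
  have "open_at D S (last xs) v (hd zs)" if ne: "xs \<noteq> []" "zs \<noteq> []"
  proof -
    note o = o1[OF ne(1)] o2[OF ne(2)]
    show ?thesis
    proof (cases "(last xs, v) \<in> D \<and> (hd zs, v) \<in> D")
      case True
      have "\<exists>s\<in>S. (v, s) \<in> D\<^sup>*"
      proof (cases "(c, v) \<in> D \<or> (last ys, v) \<in> D")
        case True
        then show ?thesis using o \<open>(last xs, v) \<in> D \<and> (hd zs, v) \<in> D\<close> ys
          by (auto simp: open_at_def split: if_splits)
      next
        case False
        then have "(v, c) \<in> D" "(v, last ys) \<in> D" using adj adj' by auto
        then show ?thesis
          using 2(1) ys by (intro open_walk_turns[OF ac, of S v c "ys' @ [v]"])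
            (auto simp: butlast_append)
      qed
      then show ?thesis using True by (simp add: open_at_def)
    next
      case False
      then show ?thesis using o by (auto simp: open_at_def split: if_splits)
    qed
  qed
  then show ?thesis using 1 2 by (subst open_walk_append) auto
qed

lemma open_walk_distinct:
  assumes ac: "acyclic D" and "open_walk D S p"
  shows "\<exists>q. open_walk D S q \<and> hd q = hd p \<and> last q = last p \<and> distinct q"
  using assms(2)
proof (induction "length p" arbitrary: p rule: less_induct)
  case less
  show ?case
  proof (cases "distinct p")
    case False
    then obtain xs v ys zs where p: "p = xs @ [v] @ ys @ [v] @ zs"
      using not_distinct_decomp by blast
    then have "open_walk D S (xs @ v # zs)"
      using open_walk_cut_loop[OF ac, of S xs v ys zs] less.prems by simp
    from less.hyps[OF _ this] p show ?thesis by (auto simp: hd_append)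
  qed (use less.prems in blast)
qed

lemma open_walk_nth:
  assumes "open_walk D S p"
  shows "Suc i < length p \<Longrightarrow> (p ! i, p ! Suc i) \<in> D \<or> (p ! Suc i, p ! i) \<in> D"
    and "i + 2 < length p \<Longrightarrow> open_at D S (p ! i) (p ! (i + 1)) (p ! (i + 2))"
proof -
  have "(Suc i < length p \<longrightarrow> (p ! i, p ! Suc i) \<in> D \<or> (p ! Suc i, p ! i) \<in> D) \<and>
        (i + 2 < length p \<longrightarrow> open_at D S (p ! i) (p ! (i + 1)) (p ! (i + 2)))"
    using assms
  proof (induction p arbitrary: i rule: open_walk.induct)
    case (3 D S a b p)
    then show ?case by (cases i; cases p) auto
  qed auto
  then show "Suc i < length p \<Longrightarrow> (p ! i, p ! Suc i) \<in> D \<or> (p ! Suc i, p ! i) \<in> D"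
    and "i + 2 < length p \<Longrightarrow> open_at D S (p ! i) (p ! (i + 1)) (p ! (i + 2))"
    by auto
qed

lemma open_walk_not_blocks:
  assumes ac: "acyclic (edges G)" and "open_walk (edges G) S p"
  shows "\<not> blocks G S p"
proof
  assume "blocks G S p"
  then obtain i where i: "i + 2 < length p"
    and *: "((chain G (p ! i) (p ! (i + 1)) (p ! (i + 2)) \<or> chain G (p ! (i + 2)) (p ! (i + 1)) (p ! i) \<or>
              fork G (p ! i) (p ! (i + 1)) (p ! (i + 2))) \<and> p ! (i + 1) \<in> S) \<or>
            (collider G (p ! i) (p ! (i + 1)) (p ! (i + 2)) \<and>
              (\<forall>s\<in>S. (p ! (i + 1), s) \<notin> (edges G)\<^sup>*))"
    unfolding blocks_def Let_def by blast
  have "(b, a) \<notin> edges G" if "(a, b) \<in> edges G" for a b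
    using that ac by (meson acyclic_def trancl.intros)
  then show False
    using * open_walk_nth(2)[OF assms(2) i]
    by (auto simp: open_at_def chain_def fork_def collider_def split: if_splits)
qed

text \<open>The definition of d-separation speaks of simple paths, while the constructions below
  produce walks with possible repetitions; cutting loops bridges the two.\<close>

lemma d_separated_no_open_walk:
  assumes ac: "acyclic (edges G)" and sub: "edges G \<subseteq> nodes G \<times> nodes G"
    and sep: "d_separated G S a b" and "a \<in> nodes G"
    and p: "open_walk (edges G) S p" "hd p = a" "last p = b"
  shows False
proof -
  obtain q where q: "open_walk (edges G) S q" "hd q = a" "last q = b" "distinct q"
    using open_walk_distinct[OF ac p(1)] p by blast
  have ne: "q \<noteq> []" using q(1) by auto
  have "q ! i \<in> nodes G" if "i < length q" for i
  proof (cases i)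
    case 0
    then show ?thesis using q(2) \<open>a \<in> nodes G\<close> ne by (simp add: hd_conv_nth)
  next
    case (Suc j)
    then show ?thesis using open_walk_nth(1)[OF q(1), of j] that sub by auto
  qed
  then have "is_path G a q b"
    using q ne open_walk_nth(1)[OF q(1)] by (auto simp: is_path_def in_set_conv_nth)
  then show False
    using sep open_walk_not_blocks[OF ac q(1)] by (auto simp: d_separated_def)
qed

section \<open>The side of the conditioning set on which \<open>b\<close> lies\<close>

text \<open>Without the ancestor clause the set need not be closed under parents: a child of
  \<open>b\<close> with no descendant in \<open>S\<close> reaches \<open>b\<close> by one edge, but
  is a closed collider between \<open>b\<close> and its other parents.\<close>

definition walk_side :: "('n \<times> 'n) set \<Rightarrow> 'n set \<Rightarrow> 'n \<Rightarrow> 'n \<Rightarrow> 'n set" where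
  "walk_side D S a b =
     {n. n \<notin> S \<and> (\<exists>t\<in>insert a (insert b S). (n, t) \<in> D\<^sup>*) \<and>
         (\<exists>p. open_walk D S p \<and> hd p = n \<and> last p = b)}"

text \<open>The edge from \<open>hd p\<close> to \<open>n\<close> rules out a collider at
  \<open>hd p\<close>, so it is enough that \<open>hd p\<close> avoids \<open>S\<close>.\<close>

lemma open_walk_Cons_child:
  assumes "acyclic D" "open_walk D S p" "(hd p, n) \<in> D" "hd p \<notin> S"
  shows "open_walk D S (n # p)"
proof -
  obtain m q where p: "p = m # q" using assms(2) by (cases p) auto
  have "(n, m) \<notin> D"
    using assms(1,3) p by (metis acyclic_def list.sel(1) trancl.simps)
  then show ?thesis using assms p by (auto simp: open_at_def)
qed

text \<open>The directed path from \<open>n\<close> to \<open>c\<close> is put backwards in front of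
  \<open>p\<close>. Its nodes descend from \<open>n\<close> and so avoid \<open>S\<close>, and none
  of the new inner nodes is a collider.\<close>

lemma open_walk_along:
  assumes "acyclic D" and "(n, c) \<in> D\<^sup>*" and "\<And>s. s \<in> S \<Longrightarrow> (n, s) \<notin> D\<^sup>*"
    and "open_walk D S p" "hd p = n"
  shows "\<exists>q. open_walk D S q \<and> hd q = c \<and> last q = last p"
  using assms(2)
proof (induction rule: rtrancl_induct)
  case base
  then show ?case using assms by blast
next
  case (step y z)
  then obtain q where q: "open_walk D S q" "hd q = y" "last q = last p" by blast
  have "y \<notin> S" using step.hyps(1) assms(3) by blast
  then have "open_walk D S (z # q)"
    using open_walk_Cons_child[OF assms(1) q(1)] q step.hyps by simp
  moreover have "q \<noteq> []" using q(1) by auto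
  ultimately show ?case using q by (intro exI[of _ "z # q"]) simp
qed

text \<open>The last conjunct records that the walk leaves \<open>n\<close> forwards, so that a
  parent of \<open>n\<close> put in front forms a chain and not a collider.\<close>

lemma open_walk_directed:
  assumes "acyclic D" and "(n, c) \<in> D\<^sup>*" and "\<And>s. s \<in> S \<Longrightarrow> (n, s) \<notin> D\<^sup>*"
  shows "\<exists>q. open_walk D S q \<and> hd q = n \<and> last q = c \<and> (tl q \<noteq> [] \<longrightarrow> (n, hd (tl q)) \<in> D)"
  using assms(2,3)
proof (induction rule: converse_rtrancl_induct)
  case base
  then show ?case by (intro exI[of _ "[c]"]) simp
next
  case (step y z)
  have "(z, s) \<notin> D\<^sup>*" if "s \<in> S" for s
    using step.prems[OF that] step.hyps(1) by (meson converse_rtrancl_into_rtrancl)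
  then obtain q where q: "open_walk D S q" "hd q = z" "last q = c"
      "tl q \<noteq> [] \<longrightarrow> (z, hd (tl q)) \<in> D" and "z \<notin> S"
    using step.IH by blast
  obtain r where r: "q = z # r" using q by (cases q) auto
  have "(x, z) \<notin> D" if "(z, x) \<in> D" for x
    using that assms(1) by (meson acyclic_def trancl.intros)
  then have "open_walk D S (y # q)"
    using q r step.hyps(1) \<open>z \<notin> S\<close> by (auto simp: open_at_def)
  then show ?case using q r step.hyps(1) by (intro exI[of _ "y # q"]) auto
qed

section \<open>Closure of the side under children, parents and co-parents\<close>

context
  fixes D :: "('n \<times> 'n) set" and S :: "'n set" and a b :: 'n
  assumes ac: "acyclic D"
    and no_walk: "\<And>p. open_walk D S p \<Longrightarrow> hd p = a \<Longrightarrow> last p \<noteq> b"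
begin

lemma walk_side_child:
  assumes "m \<in> walk_side D S a b" "(m, n) \<in> D" "n \<notin> S"
    and "\<exists>t\<in>insert a (insert b S). (n, t) \<in> D\<^sup>*"
  shows "n \<in> walk_side D S a b"
proof -
  obtain p where p: "open_walk D S p" "hd p = m" "last p = b" and "m \<notin> S"
    using assms(1) by (auto simp: walk_side_def)
  have "open_walk D S (n # p)"
    using open_walk_Cons_child[OF ac p(1)] p assms(2) \<open>m \<notin> S\<close> by simp
  moreover have "p \<noteq> []" using p by auto
  ultimately have "\<exists>q. open_walk D S q \<and> hd q = n \<and> last q = b"
    using p by (intro exI[of _ "n # p"]) simp
  then show ?thesis using assms by (simp add: walk_side_def)
qed

lemma walk_side_parent:
  assumes "n \<in> walk_side D S a b" "(m, n) \<in> D" "m \<notin> S"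
  shows "m \<in> walk_side D S a b"
proof -
  obtain p where p: "open_walk D S p" "hd p = n" "last p = b" and "n \<notin> S"
    and anc: "\<exists>t\<in>insert a (insert b S). (n, t) \<in> D\<^sup>*"
    using assms(1) by (auto simp: walk_side_def)
  \<comment> \<open>If \<open>n\<close> has no descendant in \<open>S\<close>, then it could become a closed collider on \<open>m # p\<close>, so \<open>p\<close> is
    replaced by a directed path from \<open>n\<close> to \<open>b\<close>; without such a path, \<open>n\<close> would be an ancestor of \<open>a\<close>
    and \<open>p\<close> would extend to an open walk from \<open>a\<close>.\<close>
  have "\<exists>q. open_walk D S q \<and> hd q = n \<and> last q = b \<and>
            (tl q \<noteq> [] \<longrightarrow> (n, hd (tl q)) \<in> D \<or> (\<exists>s\<in>S. (n, s) \<in> D\<^sup>*))"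
  proof (cases "\<exists>s\<in>S. (n, s) \<in> D\<^sup>*")
    case True
    then show ?thesis using p by blast
  next
    case False
    then have "(n, a) \<notin> D\<^sup>*"
      using open_walk_along[OF ac _ _ p(1,2), of a] no_walk p(3) by metis
    then have "(n, b) \<in> D\<^sup>*" using anc False by blast
    then show ?thesis using open_walk_directed[OF ac, of n b S] False by blast
  qed
  then obtain q where q: "open_walk D S q" "hd q = n" "last q = b"
      "tl q \<noteq> [] \<longrightarrow> (n, hd (tl q)) \<in> D \<or> (\<exists>s\<in>S. (n, s) \<in> D\<^sup>*)" by blast
  obtain r where r: "q = n # r" using q by (cases q) auto
  have "(x, n) \<notin> D" if "(n, x) \<in> D" for x
    using that ac by (meson acyclic_def trancl.intros)
  then have "open_walk D S (m # q)"
    using q r assms(2) \<open>n \<notin> S\<close> by (auto simp: open_at_def)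
  then have "\<exists>p. open_walk D S p \<and> hd p = m \<and> last p = b"
    using q r by (intro exI[of _ "m # q"]) auto
  moreover have "\<exists>t\<in>insert a (insert b S). (m, t) \<in> D\<^sup>*"
    using anc assms(2) by (meson converse_rtrancl_into_rtrancl)
  ultimately show ?thesis using assms(3) by (simp add: walk_side_def)
qed

text \<open>Here \<open>n\<close> is a collider that is opened by its own membership in
  \<open>S\<close>.\<close>

lemma walk_side_coparent:
  assumes "m \<in> walk_side D S a b" "(m, n) \<in> D" "(m', n) \<in> D" "n \<in> S" "m' \<notin> S"
  shows "m' \<in> walk_side D S a b"
proof -
  obtain p where p: "open_walk D S p" "hd p = m" "last p = b" and "m \<notin> S"
    using assms(1) by (auto simp: walk_side_def)
  have "open_walk D S (n # p)"
    using open_walk_Cons_child[OF ac p(1)] p assms(2) \<open>m \<notin> S\<close> by simp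
  moreover have "p \<noteq> []" using p by auto
  ultimately have "open_walk D S (m' # n # p)"
    using assms p by (auto simp: open_at_def)
  then have "\<exists>q. open_walk D S q \<and> hd q = m' \<and> last q = b"
    using p \<open>p \<noteq> []\<close> by (intro exI[of _ "m' # n # p"]) simp
  moreover have "\<exists>t\<in>insert a (insert b S). (m', t) \<in> D\<^sup>*"
    using assms(3,4) by blast
  ultimately show ?thesis using assms(5) by (simp add: walk_side_def)
qed

text \<open>\<open>v\<close> takes its roots in the side of \<open>b\<close> from \<open>u\<close> and all others from \<open>u'\<close>.\<close>

lemma merge_values:
  fixes f :: "'n \<Rightarrow> 'w \<Rightarrow> 'b" and roots :: "'n set"
  assumes wf: "wf D"
    and det: "\<And>n w w'. n \<notin> roots \<Longrightarrow> (\<And>m. (m, n) \<in> D \<Longrightarrow> f m w = f m w') \<Longrightarrow> f n w = f n w'"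
    and S: "S \<inter> roots = {}" "\<And>n. n \<in> S \<Longrightarrow> f n u = f n u'"
    and roots: "\<And>n. n \<in> roots \<Longrightarrow> f n v = (if n \<in> walk_side D S a b then f n u else f n u')"
    and "\<exists>t\<in>insert a (insert b S). (n, t) \<in> D\<^sup>*"
  shows "f n v = (if n \<in> walk_side D S a b then f n u else f n u')"
  using wf assms(6)
proof (induction n rule: wf_induct_rule)
  case (less n)
  let ?R = "walk_side D S a b"
  have R_S: "n \<notin> ?R" if "n \<in> S" for n using that by (simp add: walk_side_def)
  have IH: "f m v = (if m \<in> ?R then f m u else f m u')" if "(m, n) \<in> D" for m
    using that less.prems by (intro less.IH) (meson converse_rtrancl_into_rtrancl)+
  consider "n \<in> roots" | "n \<notin> roots" "n \<in> ?R" | "n \<notin> roots" "n \<notin> ?R" "n \<notin> S" | "n \<in> S"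
    by blast
  then show ?case
  proof cases
    case 1
    then show ?thesis by (rule roots)
  next
    \<comment> \<open>Parents outside \<open>S\<close> are on the side of \<open>b\<close> as well,
      and parents in \<open>S\<close> have the same value under \<open>u\<close> and
      \<open>u'\<close>.\<close>
    case 2
    have "f m v = f m u" if m: "(m, n) \<in> D" for m
      using IH[OF m] walk_side_parent[OF 2(2) m] S(2)[of m] by (cases "m \<in> S") auto
    then have "f n v = f n u" by (rule det[OF 2(1)])
    then show ?thesis using 2(2) by simp
  next
    \<comment> \<open>A parent on the side of \<open>b\<close> would bring \<open>n\<close> with it,
      since \<open>n\<close> is outside \<open>S\<close>.\<close>
    case 3
    have "f m v = f m u'" if m: "(m, n) \<in> D" for m
      using IH[OF m] walk_side_child[OF _ m 3(3) less.prems] 3(2) by auto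
    then have "f n v = f n u'" by (rule det[OF 3(1)])
    then show ?thesis using 3(2) by simp
  next
    \<comment> \<open>One parent on the side of \<open>b\<close> forces all parents outside
      \<open>S\<close> onto it. So all parents can be read from a single one of \<open>u\<close> and
      \<open>u'\<close>, and these agree at \<open>n\<close>.\<close>
    case 4
    then have n: "n \<notin> roots" "n \<notin> ?R" using S(1) R_S by auto
    show ?thesis
    proof (cases "\<exists>k\<in>?R. (k, n) \<in> D")
      case True
      then obtain k where k: "k \<in> ?R" "(k, n) \<in> D" by blast
      have "f m v = f m u" if m: "(m, n) \<in> D" for m
        using IH[OF m] walk_side_coparent[OF k m 4] S(2)[of m] by (cases "m \<in> S") auto
      then have "f n v = f n u" by (rule det[OF n(1)])
      then show ?thesis using n S(2)[OF 4] by simp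
    next
      case False
      then have "f m v = f m u'" if "(m, n) \<in> D" for m
        using IH[OF that] that by auto
      then have "f n v = f n u'" by (rule det[OF n(1)])
      then show ?thesis using n by simp
    qed
  qed
qed

end

section \<open>Reinstating the exogenous variables of the teleporters\<close>

text \<open>Every new node has a single neighbour, so a simple path between old nodes cannot pass
  through it, and no old node gains a descendant.\<close>

lemma d_separated_add_roots:
  assumes sep: "d_separated G S a b"
    and sub: "edges G \<subseteq> nodes G \<times> nodes G"
    and T: "T \<inter> nodes G = {}" "h ` T \<subseteq> nodes G"
    and ab: "a \<in> nodes G" "b \<in> nodes G"
  shows "d_separated \<lparr>nodes = nodes G \<union> T, edges = edges G \<union> (\<lambda>t. (t, h t)) ` T\<rparr> S a b"
proof -
  define H where "H = \<lparr>nodes = nodes G \<union> T, edges = edges G \<union> (\<lambda>t. (t, h t)) ` T\<rparr>"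
  have H: "nodes H = nodes G \<union> T" "edges H = edges G \<union> (\<lambda>t. (t, h t)) ` T"
    by (simp_all add: H_def)
  have leaf: "n = h t" if "(t, n) \<in> edges H \<or> (n, t) \<in> edges H" "t \<in> T" for t n
    using that sub T by (auto simp: H)
  have old: "(m, n) \<in> edges G" if "(m, n) \<in> edges H" "m \<notin> T" for m n
    using that by (auto simp: H)
  have reach: "n \<notin> T \<and> (m, n) \<in> (edges G)\<^sup>*" if "(m, n) \<in> (edges H)\<^sup>*" "m \<notin> T" for m n
    using that(1)
  proof (induction rule: rtrancl_induct)
    case (step y z)
    then have "(y, z) \<in> edges G" using old by blast
    then show ?case using step.IH sub T(1) by (auto intro: rtrancl_into_rtrancl)
  qed (use that(2) in simp)
  have "blocks H S p" if p: "is_path H a p b" for p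
  proof -
    have adj: "(p ! i, p ! Suc i) \<in> edges H \<or> (p ! Suc i, p ! i) \<in> edges H"
      if "Suc i < length p" for i
      using p that by (simp add: is_path_def)
    have noT: "p ! i \<notin> T" if i: "i < length p" for i
    proof
      assume t: "p ! i \<in> T"
      have "p \<noteq> []" "p ! 0 = a" "p ! (length p - 1) = b"
        using p by (auto simp: is_path_def hd_conv_nth last_conv_nth)
      then have "i \<noteq> 0" "i \<noteq> length p - 1" using t ab T(1) by auto
      then obtain j where j: "i = Suc j" "Suc i < length p" using i by (cases i) auto
      have "(p ! j, p ! i) \<in> edges H \<or> (p ! i, p ! j) \<in> edges H"
        using adj[of j] i j(1) by simp
      then have "p ! j = h (p ! i)" using leaf[OF _ t] by blast
      moreover have "p ! Suc i = h (p ! i)" using leaf[OF _ t] adj[OF j(2)] by blast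
      ultimately have "p ! j = p ! Suc i" by simp
      then show False
        using p j by (simp add: is_path_def nth_eq_iff_index_eq)
    qed
    have "is_path G a p b"
      unfolding is_path_def
    proof (intro conjI allI impI)
      show "set p \<subseteq> nodes G"
      proof -
        have "set p \<inter> T = {}" using noT by (auto simp: in_set_conv_nth)
        moreover have "set p \<subseteq> nodes G \<union> T" using p by (simp add: is_path_def H)
        ultimately show ?thesis by blast
      qed
      show "(p ! i, p ! Suc i) \<in> edges G \<or> (p ! Suc i, p ! i) \<in> edges G"
        if "Suc i < length p" for i
        using adj[OF that] old noT[of i] noT[of "Suc i"] that by auto
    qed (use p in \<open>auto simp: is_path_def\<close>)
    then have "blocks G S p" using sep by (simp add: d_separated_def)
    then obtain i where i: "i + 2 < length p"
      and *: "((chain G (p ! i) (p ! (i + 1)) (p ! (i + 2)) \<or> chain G (p ! (i + 2)) (p ! (i + 1)) (p ! i) \<or>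
                fork G (p ! i) (p ! (i + 1)) (p ! (i + 2))) \<and> p ! (i + 1) \<in> S) \<or>
              (collider G (p ! i) (p ! (i + 1)) (p ! (i + 2)) \<and>
                (\<forall>s\<in>S. (p ! (i + 1), s) \<notin> (edges G)\<^sup>*))"
      unfolding blocks_def Let_def by blast
    have "\<forall>s\<in>S. (p ! (i + 1), s) \<notin> (edges H)\<^sup>*"
      if "\<forall>s\<in>S. (p ! (i + 1), s) \<notin> (edges G)\<^sup>*"
      using that reach noT[of "i + 1"] i by auto
    moreover have "chain G u v w \<Longrightarrow> chain H u v w" "fork G u v w \<Longrightarrow> fork H u v w"
      "collider G u v w \<Longrightarrow> collider H u v w" for u v w
      by (auto simp: chain_def fork_def collider_def H)
    ultimately show ?thesis
      unfolding blocks_def Let_def using i * by blast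
  qed
  then show ?thesis
    using sep by (simp add: d_separated_def H_def)
qed

text \<open>The exogenous variables of the teleporters are restored, so that every endogenous node is a
  function of its parents alone.\<close>

definition exo_cross_world_graph :: "('v, 'a, 'u) scm \<Rightarrow> 'v \<Rightarrow> 'v node digraph" where
  "exo_cross_world_graph M X =
     (let T = Exo ` {i \<in> endo M. Real i \<in> teleporters M X} in
      \<lparr>nodes = nodes (cross_world_graph M X) \<union> T,
       edges = edges (cross_world_graph M X) \<union>
               (\<lambda>t. (t, case t of Exo i \<Rightarrow> Real i | _ \<Rightarrow> t)) ` T\<rparr>)"

section \<open>Solutions, interventions and the values of cross-world nodes\<close>

context causal_model
begin

lemma solves_solution: "solves M u (solution M u)"
  unfolding solution_def using ex1_solves by (rule theI')

lemma solution_eqI: "solves M u v \<Longrightarrow> solution M u = v"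
  using ex1_solves solves_solution by blast

lemma solution_eqn:
  "i \<in> endo M \<Longrightarrow> solution M u i = eqn M i (restrict (solution M u) (parents M i)) (u i)"
  using solves_solution[of u] by (simp add: solves_def)

lemma solution_undefined: "i \<notin> endo M \<Longrightarrow> solution M u i = undefined"
  using solves_solution[of u] by (auto simp: solves_def extensional_def)

lemma solution_in_val:
  assumes "u \<in> PiE (endo M) (exo_val M)" and "i \<in> endo M"
  shows "solution M u i \<in> val M i"
  using wf_parents assms(2)
proof (induction i rule: wf_induct_rule)
  case (less i)
  have "restrict (solution M u) (parents M i) \<in> PiE (parents M i) (val M)"
    using less parents_subset by fastforce
  from eqn_val[OF less.prems this PiE_mem[OF assms(1) less.prems]] show ?case
    using solution_eqn[OF less.prems] by simp
qed

lemma proper_desc_parent: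
  assumes "i \<in> endo M" "j \<in> parents M i" "j = X \<or> j \<in> proper_desc M X"
  shows "i \<in> proper_desc M X"
proof -
  have "(Real j, Real i) \<in> edges (scm_graph M)"
    using assms by (auto simp: scm_graph_def)
  then show ?thesis
    using assms by (auto simp: proper_desc_def intro: trancl_into_trancl)
qed

lemma self_not_proper_desc: "X \<notin> proper_desc M X"
  using acyclic_graph by (auto simp: proper_desc_def acyclic_def)

context
  fixes X :: 'v and x :: 'a
  assumes X: "X \<in> endo M" and x: "x \<in> val M X"
begin

interpretation Mx: causal_model "intervene M X x"
  by (rule causal_model_intervene[OF x])

lemma solution_intervene_self: "solution (intervene M X x) u X = x"
  using Mx.solution_eqn[of X u] X by (simp add: intervene_def)

lemma solution_intervene_eqn:
  assumes "i \<in> endo M" "i \<noteq> X"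
  shows "solution (intervene M X x) u i =
           eqn M i (restrict (solution (intervene M X x) u) (parents M i)) (u i)"
proof -
  have "i \<in> endo (intervene M X x)" using assms by (simp add: intervene_def)
  from Mx.solution_eqn[OF this] show ?thesis
    using assms by (simp add: intervene_def)
qed

text \<open>A parent that is \<open>X\<close> or descends from \<open>X\<close> would make
  \<open>i\<close> a descendant, so the induction stays among non-descendants. This is why both
  worlds can share the node of a teleporter.\<close>

lemma solution_intervene_nondesc:
  assumes "i \<in> endo M" "i \<noteq> X" "i \<notin> proper_desc M X"
  shows "solution (intervene M X x) u i = solution M u i"
  using wf_parents assms
proof (induction i rule: wf_induct_rule)
  case (less i)
  have "solution (intervene M X x) u j = solution M u j" if "j \<in> parents M i" for j
    using that less.prems parents_subset proper_desc_parent[of i j X]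
    by (intro less.IH) auto
  then have "restrict (solution (intervene M X x) u) (parents M i) =
             restrict (solution M u) (parents M i)"
    by (rule restrict_ext)
  then show ?case
    using less.prems solution_eqn solution_intervene_eqn by simp
qed

text \<open>The consistency rule: the real solution also satisfies the replaced equation for
  \<open>X\<close>, and solutions are unique.\<close>

lemma solution_intervene_consistent:
  assumes "solution M u X = x"
  shows "solution (intervene M X x) u = solution M u"
proof (rule Mx.solution_eqI)
  show "solves (intervene M X x) u (solution M u)"
    using solves_solution[of u] assms by (auto simp: solves_def intervene_def)
qed

text \<open>\<open>Inl\<close> carries endogenous values and \<open>Inr\<close> noise.
  \<open>Exo\<close> and \<open>Cf\<close> nodes outside the graph have no incoming edges, so only a
  constant value, here \<open>Inl x\<close>, is compatible with
  \<open>node_value_determined\<close>.\<close>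

fun node_value :: "'v node \<Rightarrow> ('v \<Rightarrow> 'u) \<Rightarrow> 'a + 'u" where
  "node_value (Real i) u = Inl (solution M u i)"
| "node_value (Exo i) u = (if i \<in> endo M then Inr (u i) else Inl x)"
| "node_value Const u = Inl x"
| "node_value (Cf i) u =
     (if i \<in> proper_desc M X then Inl (solution (intervene M X x) u i) else Inl x)"

text \<open>With the noise of the teleporters restored, the real edges are simply those of
  \<open>scm_graph M\<close>. The three kinds of non-exogenous parents of \<open>Cf i\<close> merge
  into one family.\<close>

lemma edges_exo_cross_world_graph:
  "edges (exo_cross_world_graph M X) =
     {(Real j, Real i) | i j. i \<in> endo M \<and> j \<in> parents M i} \<union>
     {(Exo i, Real i) | i. i \<in> endo M} \<union>
     {(Exo i, Cf i) | i. i \<in> proper_desc M X} \<union>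
     {(if j = X then Const else cf_node M X j, Cf i) | i j.
        i \<in> proper_desc M X \<and> j \<in> parents M i}"
  (is "?L = ?R1 \<union> ?R2 \<union> ?R3 \<union> ?R4")
proof -
  have pd: "D \<in> endo M" if "D \<in> proper_desc M X" for D
    using that by (simp add: proper_desc_def)
  have tp: "Real j \<in> teleporters M X \<longleftrightarrow> j \<noteq> X \<and> j \<notin> proper_desc M X"
    if "i \<in> endo M" "j \<in> parents M i" for i j
    using that endo_teleporter_iff[OF _ X] parents_subset by blast
  have 1: "?L = {(a, b) \<in> edges (scm_graph M). a \<in> real_world_nodes M X \<and> b \<in> real_world_nodes M X} \<union>
       {(Exo i, Real i) | i. i \<in> endo M \<and> Real i \<in> teleporters M X} \<union> ?R3 \<union>
        ({(Real B, Cf D) | B D. D \<in> proper_desc M X \<and> B \<in> parents M D \<and>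
                               Real B \<in> teleporters M X} \<union>
        {(Cf B, Cf D) | B D. D \<in> proper_desc M X \<and> B \<in> parents M D \<and>
                             B \<in> proper_desc M X} \<union>
        {(Const, Cf D) | D. D \<in> proper_desc M X \<and> X \<in> parents M D})" (is "_ = ?A \<union> ?B \<union> _ \<union> ?C")
    unfolding exo_cross_world_graph_def cross_world_graph_def Let_def
    by (auto simp: image_iff)
  have 2: "?A \<union> ?B = ?R1 \<union> ?R2"
    using parents_subset by (auto simp: scm_graph_def real_world_nodes_def)
  have 3: "?C = ?R4"
    using tp pd self_not_proper_desc[of X]
    by (auto simp: cf_node_def split: if_splits) metis+
  show ?thesis by (simp only: 1 2 3)
qed

lemma node_value_cf_parent:
  assumes "j \<in> endo M"
  shows "node_value (if j = X then Const else cf_node M X j) u =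
           Inl (solution (intervene M X x) u j)"
  using assms solution_intervene_self solution_intervene_nondesc by (simp add: cf_node_def)

text \<open>Supplies the hypothesis \<open>det\<close> of \<open>merge_values\<close>: every
  argument of a structural equation, including the noise of a teleporter, is now a parent in the
  graph.\<close>

lemma node_value_determined:
  assumes "n \<notin> Exo ` endo M"
    and eq: "\<And>m. (m, n) \<in> edges (exo_cross_world_graph M X) \<Longrightarrow> node_value m w = node_value m w'"
  shows "node_value n w = node_value n w'"
proof (cases n)
  case (Real i)
  show ?thesis
  proof (cases "i \<in> endo M")
    case True
    have "solution M w j = solution M w' j" if "j \<in> parents M i" for j
      using eq[of "Real j"] that True Real by (simp add: edges_exo_cross_world_graph)
    then have "restrict (solution M w) (parents M i) = restrict (solution M w') (parents M i)"
      by (rule restrict_ext)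
    moreover have "w i = w' i"
      using eq[of "Exo i"] True Real by (simp add: edges_exo_cross_world_graph)
    ultimately show ?thesis using True Real by (simp add: solution_eqn)
  qed (simp add: Real solution_undefined)
next
  case (Cf i)
  show ?thesis
  proof (cases "i \<in> proper_desc M X")
    case True
    then have i: "i \<in> endo M" "i \<noteq> X"
      using self_not_proper_desc[of X] by (auto simp: proper_desc_def)
    have "solution (intervene M X x) w j = solution (intervene M X x) w' j"
      if "j \<in> parents M i" for j
    proof -
      have "(if j = X then Const else cf_node M X j, n) \<in> edges (exo_cross_world_graph M X)"
        using that True Cf unfolding edges_exo_cross_world_graph by blast
      from eq[OF this] show ?thesis
        using that i(1) parents_subset by (subst (asm) (1 2) node_value_cf_parent) auto
    qed
    then have "restrict (solution (intervene M X x) w) (parents M i) =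
               restrict (solution (intervene M X x) w') (parents M i)"
      by (rule restrict_ext)
    moreover have "w i = w' i"
      using eq[of "Exo i"] True i Cf by (simp add: edges_exo_cross_world_graph)
    ultimately show ?thesis
      using True Cf solution_intervene_eqn[OF i] by simp
  qed (simp add: Cf)
qed (use assms in auto)

text \<open>Since \<open>Cf i\<close> can have parents of the form \<open>Real j\<close> and
  \<open>Cf j\<close>, both copies of a variable are treated in one induction over the parents in
  \<open>M\<close>.\<close>

lemma wf_exo_cross_world_graph: "wf (edges (exo_cross_world_graph M X))"
proof (rule wfUNIVI)
  fix Q and n :: "'v node"
  assume "\<forall>n. (\<forall>m. (m, n) \<in> edges (exo_cross_world_graph M X) \<longrightarrow> Q m) \<longrightarrow> Q n"
  then have step: "Q n" if "\<And>m. (m, n) \<in> edges (exo_cross_world_graph M X) \<Longrightarrow> Q m" for n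
    using that by blast
  have root: "Q (Exo i)" "Q Const" for i
    by (rule step; simp add: edges_exo_cross_world_graph)+
  have "Q (Real i) \<and> Q (Cf i)" for i
    using wf_parents
  proof (induction i rule: wf_induct_rule)
    case (less i)
    show ?case
    proof (intro conjI; rule step)
      fix m
      show "Q m" if "(m, Real i) \<in> edges (exo_cross_world_graph M X)"
        using that less root by (auto simp: edges_exo_cross_world_graph)
      show "Q m" if "(m, Cf i) \<in> edges (exo_cross_world_graph M X)"
        using that less root
        by (auto simp: edges_exo_cross_world_graph cf_node_def proper_desc_def)
    qed
  qed
  with root show "Q n" by (cases n) auto
qed

lemma edges_cross_world_graph_subset:
  "edges (cross_world_graph M X) \<subseteq> nodes (cross_world_graph M X) \<times> nodes (cross_world_graph M X)"
proof -
  have pd: "D \<in> endo M \<and> Real D \<notin> teleporters M X" if "D \<in> proper_desc M X" for D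
    using that endo_teleporter_iff[OF _ X] by (auto simp: proper_desc_def)
  show ?thesis
    using parents_subset pd by (auto simp: cross_world_graph_def real_world_nodes_def)
qed

lemma edges_exo_cross_world_graph_subset:
  "edges (exo_cross_world_graph M X) \<subseteq>
     nodes (exo_cross_world_graph M X) \<times> nodes (exo_cross_world_graph M X)"
proof -
  have "Real i \<in> nodes (cross_world_graph M X)" if "i \<in> endo M" for i
    using that by (simp add: cross_world_graph_def real_world_nodes_def)
  then show ?thesis
    using edges_cross_world_graph_subset by (auto simp: exo_cross_world_graph_def Let_def)
qed

lemma d_separated_exo_cross_world_graph:
  assumes "d_separated (cross_world_graph M X) S (Real X) (cf_node M X Y)" "Y \<in> endo M"
  shows "d_separated (exo_cross_world_graph M X) S (Real X) (cf_node M X Y)"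
  unfolding exo_cross_world_graph_def Let_def
proof (rule d_separated_add_roots[OF assms(1) edges_cross_world_graph_subset])
qed (use X assms(2) in \<open>auto simp: cross_world_graph_def real_world_nodes_def cf_node_def\<close>)

end

end

section \<open>Splicing two noise assignments\<close>

text \<open>The set \<open>A\<close> is fixed before \<open>u\<close> and \<open>u'\<close>, so that
  one exchange map serves all pairs of noise assignments.\<close>

lemma (in causal_model) splice_noise:
  assumes X: "X \<in> endo M" and x: "x \<in> val M X" and Y: "Y \<in> endo M" "X \<noteq> Y"
    and sep: "d_separated (cross_world_graph M X) (Real ` W) (Real X) (cf_node M X Y)"
  obtains A where "A \<subseteq> endo M"
    and "\<And>u u'. (\<And>i. i \<in> W \<Longrightarrow> solution M u i = solution M u' i) \<Longrightarrow>
           (\<forall>i\<in>W. solution M (override_on u' u A) i = solution M u i) \<and>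
           solution M (override_on u' u A) X = solution M u' X \<and>
           counterfactual M X x Y (override_on u' u A) = counterfactual M X x Y u"
proof -
  define D where "D = edges (exo_cross_world_graph M X)"
  define b where "b = cf_node M X Y"
  define R where "R = walk_side D (Real ` W) (Real X) b"
  define A where "A = {i \<in> endo M. Exo i \<in> R}"
  let ?f = "node_value X x"
  have wf: "wf D" unfolding D_def by (rule wf_exo_cross_world_graph[OF X x])
  then have ac: "acyclic D" by (rule wf_acyclic)
  have sep': "d_separated (exo_cross_world_graph M X) (Real ` W) (Real X) b"
    unfolding b_def by (rule d_separated_exo_cross_world_graph[OF X x sep Y(1)])
  have "Real X \<in> nodes (exo_cross_world_graph M X)"
    using X by (simp add: exo_cross_world_graph_def Let_def cross_world_graph_def real_world_nodes_def)
  then have no_walk: "last p \<noteq> b" if "open_walk D (Real ` W) p" "hd p = Real X" for p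
    using d_separated_no_open_walk[OF _ edges_exo_cross_world_graph_subset[OF X x] sep'] that ac
    unfolding D_def by blast
  have "(\<forall>i\<in>W. solution M (override_on u' u A) i = solution M u i) \<and>
        solution M (override_on u' u A) X = solution M u' X \<and>
        counterfactual M X x Y (override_on u' u A) = counterfactual M X x Y u"
    if agree: "\<And>i. i \<in> W \<Longrightarrow> solution M u i = solution M u' i" for u u'
  proof -
    define v where "v = override_on u' u A"
    have merge: "?f n v = (if n \<in> R then ?f n u else ?f n u')"
      if "\<exists>t\<in>insert (Real X) (insert b (Real ` W)). (n, t) \<in> D\<^sup>*" for n
      unfolding R_def
    proof (rule merge_values[OF ac no_walk wf, where f = ?f and roots = "Exo ` endo M" and u = u and u' = u' and v = v])
      show "?f n w = ?f n w'"
        if "n \<notin> Exo ` endo M" "\<And>m. (m, n) \<in> D \<Longrightarrow> ?f m w = ?f m w'" for n w w'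
        using node_value_determined[OF X x that(1)] that(2) unfolding D_def by blast
      show "?f n v = (if n \<in> walk_side D (Real ` W) (Real X) b then ?f n u else ?f n u')"
        if "n \<in> Exo ` endo M" for n
        using that X x
        by (auto simp: v_def A_def R_def override_on_def)
      show "?f n u = ?f n u'" if "n \<in> Real ` W" for n
        using that agree X x by auto
    qed (use that in auto)
    have "Real X \<notin> R" using no_walk by (auto simp: R_def walk_side_def)
    then have 1: "solution M v X = solution M u' X"
      using merge[of "Real X"] X x by auto
    have "b \<notin> Real ` W" using sep by (simp add: d_separated_def b_def)
    \<comment> \<open>The one-node walk at \<open>b\<close> is open, so \<open>b\<close> is on its
      own side.\<close>
    then have "b \<in> R" by (auto simp: R_def walk_side_def intro!: exI[of _ "[b]"])
    then have "?f b v = ?f b u" using merge[of b] by auto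
    then have 2: "solution (intervene M X x) v Y = solution (intervene M X x) u Y"
      using node_value_cf_parent[OF X x Y(1)] Y(2) by (simp add: b_def)
    have 3: "solution M v i = solution M u i" if "i \<in> W" for i
    proof -
      have "\<exists>t\<in>insert (Real X) (insert b (Real ` W)). (Real i, t) \<in> D\<^sup>*"
        using that by blast
      from merge[OF this] show ?thesis using agree[OF that] X x by (simp split: if_splits)
    qed
    show ?thesis using 1 2 3 by (simp add: v_def counterfactual_def)
  qed
  moreover have "A \<subseteq> endo M" by (auto simp: A_def)
  ultimately show ?thesis by (rule that[rotated])
qed

section \<open>Exchanging noise coordinates between two independent copies\<close>

lemma measure_pair_pmf_Times:
  "measure_pmf.prob (pair_pmf p q) (A \<times> B) = measure_pmf.prob p A * measure_pmf.prob q B"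
proof -
  have "measure_pmf.prob (pair_pmf p q) (A \<times> B) =
        measure_pmf.prob (pair_pmf p q) ((A \<inter> set_pmf p) \<times> (B \<inter> set_pmf q))"
    by (subst measure_Int_set_pmf[symmetric]) (simp add: Times_Int_Times)
  also have "\<dots> = measure_pmf.prob p (A \<inter> set_pmf p) * measure_pmf.prob q (B \<inter> set_pmf q)"
    by (intro measure_pmf_prob_product countable_Int2 countable_set_pmf)
  finally show ?thesis by (simp add: measure_Int_set_pmf)
qed

context probabilistic_causal_model
begin

text \<open>Up to a null set, \<open>{u}\<close> is an intersection of independent coordinate
  events, because assignments in the support are extensional and hence fixed by their coordinates in
  \<open>endo M\<close>.\<close>

lemma pmf_eq_prod:
  assumes "u \<in> extensional (endo M)" and "endo M \<noteq> {}"
  shows "pmf P u = (\<Prod>i\<in>endo M. pmf (map_pmf (\<lambda>w. w i) P) (u i))"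
proof -
  let ?J = "\<Inter>i\<in>endo M. (\<lambda>w. w i) -` {u i} \<inter> space (measure_pmf P)"
  have "pmf P u = measure_pmf.prob P {u}" by (simp add: measure_pmf_single)
  also have "\<dots> = measure_pmf.prob P ?J"
  proof (rule measure_pmf.finite_measure_eq_AE)
    show "AE w in measure_pmf P. (w \<in> {u}) = (w \<in> ?J)"
    proof (rule AE_pmfI)
      fix w assume "w \<in> set_pmf P"
      then have "w \<in> extensional (endo M)" using support by (auto simp: PiE_def)
      then show "(w \<in> {u}) = (w \<in> ?J)"
        using assms by (auto intro: extensionalityI)
    qed
  qed auto
  also have "\<dots> = (\<Prod>i\<in>endo M. measure_pmf.prob P ((\<lambda>w. w i) -` {u i} \<inter> space (measure_pmf P)))"
    by (rule prob_space.indep_varsD_finite[OF measure_pmf.prob_space_axioms indep_exo]) (use assms finite_endo in auto)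
  finally show ?thesis by (simp add: pmf_map)
qed

text \<open>In the product form of the mass function, the two factors of each coordinate are either
  kept or exchanged.\<close>

lemma pmf_override_on:
  assumes "A \<subseteq> endo M"
  shows "pmf P (override_on u' u A) * pmf P (override_on u u' A) = pmf P u * pmf P u'"
proof (cases "endo M = {}")
  case True
  then show ?thesis using assms by (simp add: override_on_def)
next
  case False
  let ?e = "extensional (endo M)"
  have zero: "pmf P w = 0" if "w \<notin> ?e" for w
    using that support by (auto simp: PiE_def pmf_eq_0_set_pmf)
  show ?thesis
  proof (cases "u \<in> ?e \<and> u' \<in> ?e")
    case True
    then have "override_on u' u A \<in> ?e" "override_on u u' A \<in> ?e"
      by (auto simp: extensional_def override_on_def)
    moreover have "pmf (map_pmf (\<lambda>w. w i) P) (override_on u' u A i) *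
          pmf (map_pmf (\<lambda>w. w i) P) (override_on u u' A i) =
        pmf (map_pmf (\<lambda>w. w i) P) (u i) * pmf (map_pmf (\<lambda>w. w i) P) (u' i)" for i
      by (cases "i \<in> A") (simp_all add: mult.commute)
    ultimately show ?thesis
      using True False by (simp add: pmf_eq_prod prod.distrib[symmetric])
  next
    \<comment> \<open>Coordinates outside \<open>endo M\<close> are not exchanged, so a
      non-extensional argument remains and both sides vanish.\<close>
    case outside: False
    then have "override_on u' u A \<notin> ?e \<or> override_on u u' A \<notin> ?e"
      using assms by (auto simp: extensional_def override_on_def)
    then show ?thesis using outside zero by auto
  qed
qed

lemma map_pmf_override_on:
  assumes "A \<subseteq> endo M"
  shows "map_pmf (\<lambda>(u, u'). (override_on u' u A, override_on u u' A)) (pair_pmf P P) = pair_pmf P P"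
    (is "map_pmf ?s _ = _")
proof (rule pmf_eqI)
  fix z
  have invol: "?s (?s z) = z" for z
    by (cases z) (auto simp: override_on_def)
  then have "inj ?s" by (rule inj_on_inverseI)
  then have "pmf (map_pmf ?s (pair_pmf P P)) (?s (?s z)) = pmf (pair_pmf P P) (?s z)"
    by (rule pmf_map_inj')
  also have "\<dots> = pmf (pair_pmf P P) z"
    by (cases z) (simp add: pmf_pair pmf_override_on[OF assms])
  finally show "pmf (map_pmf ?s (pair_pmf P P)) z = pmf (pair_pmf P P) z"
    by (simp only: invol)
qed

text \<open>If \<open>u\<close> and \<open>u'\<close> both give \<open>c\<close>, then exchanging
  the coordinates in \<open>A\<close> swaps their values of \<open>X\<close> and leaves each copy
  its counterfactual. This carries the event \<open>?XY \<times> ?C\<close> to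
  \<open>?Y \<times> ?X\<close> and back.\<close>

lemma prob_counterfactual_product:
  fixes C :: "('v \<Rightarrow> 'u) \<Rightarrow> 'c"
  assumes X: "X \<in> endo M" and x: "x \<in> val M X" and Y: "Y \<in> endo M" "X \<noteq> Y"
    and sep: "d_separated (cross_world_graph M X) (Real ` W) (Real X) (cf_node M X Y)"
    and C: "\<And>u u'. C u = C u' \<longleftrightarrow> (\<forall>i\<in>W. solution M u i = solution M u' i)"
  shows "measure_pmf.prob P {u. solution M u X = a \<and> counterfactual M X x Y u = b \<and> C u = c} *
           measure_pmf.prob P {u. C u = c} =
         measure_pmf.prob P {u. solution M u X = a \<and> C u = c} *
           measure_pmf.prob P {u. counterfactual M X x Y u = b \<and> C u = c}"
    (is "measure_pmf.prob P ?XY * measure_pmf.prob P ?C =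
         measure_pmf.prob P ?X * measure_pmf.prob P ?Y")
proof -
  obtain A where A: "A \<subseteq> endo M"
    and splice: "\<And>u u'. (\<And>i. i \<in> W \<Longrightarrow> solution M u i = solution M u' i) \<Longrightarrow>
           (\<forall>i\<in>W. solution M (override_on u' u A) i = solution M u i) \<and>
           solution M (override_on u' u A) X = solution M u' X \<and>
           counterfactual M X x Y (override_on u' u A) = counterfactual M X x Y u"
    using splice_noise[OF X x Y sep] by blast
  define s where "s = (\<lambda>(u :: 'v \<Rightarrow> 'u, u'). (override_on u' u A, override_on u u' A))"
  let ?Q = "pair_pmf P P"
  have splice_C: "C (override_on u' u A) = C u" "solution M (override_on u' u A) X = solution M u' X"
      "counterfactual M X x Y (override_on u' u A) = counterfactual M X x Y u" if "C u = C u'" for u u'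
    using splice[of u u'] that by (simp_all add: C)
  have to: "s z \<in> ?Y \<times> ?X" if "z \<in> ?XY \<times> ?C" for z
    using that splice_C by (auto simp: s_def)
  have invol: "s (s z) = z" for z by (cases z) (auto simp: s_def override_on_def)
  have fro: "s z \<in> ?XY \<times> ?C" if "z \<in> ?Y \<times> ?X" for z
    using that splice_C by (auto simp: s_def)
  \<comment> \<open>\<open>fro\<close> is used at \<open>s z\<close>, which the involution takes
    back to \<open>z\<close>.\<close>
  have "z \<in> s -` (?Y \<times> ?X) \<longleftrightarrow> z \<in> ?XY \<times> ?C" for z
    unfolding vimage_eq by (rule iffI[OF fro[of "s z", unfolded invol] to])
  then have "s -` (?Y \<times> ?X) = ?XY \<times> ?C" by (rule set_eqI)
  then have "measure_pmf.prob ?Q (?XY \<times> ?C) = measure_pmf.prob (map_pmf s ?Q) (?Y \<times> ?X)"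
    by simp
  also have "map_pmf s ?Q = ?Q"
    unfolding s_def by (rule map_pmf_override_on[OF A])
  finally show ?thesis
    by (simp add: mult.commute measure_pair_pmf_Times)
qed

lemma AE_obs_in_PiE:
  assumes "W \<subseteq> endo M"
  shows "AE u in measure_pmf P. obs M W u \<in> PiE W (val M)"
proof (rule AE_pmfI)
  fix u assume "u \<in> set_pmf P"
  then have "u \<in> PiE (endo M) (exo_val M)" using support by blast
  then show "obs M W u \<in> PiE W (val M)"
    using solution_in_val assms by (auto simp: obs_def)
qed

lemma prob_total_obs:
  assumes "W \<subseteq> endo M"
  shows "(\<Sum>z\<in>PiE W (val M). measure_pmf.prob P {u. Q u \<and> obs M W u = z}) =
         measure_pmf.prob P {u. Q u}"
proof -
  have fin: "finite (PiE W (val M))"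
    using assms finite_endo finite_val by (intro finite_PiE) (auto intro: finite_subset)
  have "(\<Sum>z\<in>PiE W (val M). measure_pmf.prob P {u. Q u \<and> obs M W u = z}) =
        measure_pmf.prob P (\<Union>z\<in>PiE W (val M). {u. Q u \<and> obs M W u = z})"
    by (rule measure_pmf.finite_measure_finite_Union[symmetric, OF fin])
      (auto simp: disjoint_family_on_def)
  \<comment> \<open>Noise in the support produces values in the ranges, so the union misses only a
    null set.\<close>
  also have "\<dots> = measure_pmf.prob P {u. Q u}"
    by (rule measure_pmf.finite_measure_eq_AE) (use AE_obs_in_PiE[OF assms] in auto)
  finally show ?thesis .
qed

end

section \<open>Conditional independence and the adjustment formula\<close>

theorem theorem3:
  fixes M :: "('v, 'a, 'u) scm"
    and P :: "('v \<Rightarrow> 'u) pmf"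
    and X Y :: 'v and x :: 'a
    and E Z :: "'v set" and e :: "'v \<Rightarrow> 'a"
  assumes "probabilistic_causal_model M P"
    and "X \<in> endo M" and "Y \<in> endo M" and "X \<noteq> Y"
    and "x \<in> val M X"
    and "E \<subseteq> endo M" and "Z \<subseteq> endo M"
    and "e \<in> PiE E (val M)"
    and "d_separated (cross_world_graph M X) (Real ` (E \<union> Z)) (Real X) (cf_node M X Y)"
  shows
    "cond_indep P (\<lambda>u. solution M u X) (counterfactual M X x Y) (\<lambda>u. (obs M E u, obs M Z u)) \<and>
     (\<P>(u in measure_pmf P. obs M E u = e) > 0 \<longrightarrow>
      (\<forall>z\<in>PiE Z (val M).
         \<P>(u in measure_pmf P. obs M Z u = z \<and> obs M E u = e) > 0 \<longrightarrow>
         \<P>(u in measure_pmf P. obs M Z u = z \<and> solution M u X = x \<and> obs M E u = e) > 0) \<longrightarrow>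
      (\<forall>y\<in>val M Y.
         \<P>(u in measure_pmf P. counterfactual M X x Y u = y \<bar> obs M E u = e) =
         (\<Sum>z\<in>{z \<in> PiE Z (val M). \<P>(u in measure_pmf P. obs M Z u = z \<bar> obs M E u = e) > 0}.
            \<P>(u in measure_pmf P. solution M u Y = y \<bar>
                 obs M Z u = z \<and> solution M u X = x \<and> obs M E u = e) *
            \<P>(u in measure_pmf P. obs M Z u = z \<bar> obs M E u = e))))"
proof -
  interpret probabilistic_causal_model M P by fact
  define pr where "pr Q = measure_pmf.prob P {u. Q u}" for Q
  have cond: "cond_prob (measure_pmf P) Q1 Q2 = pr (\<lambda>u. Q1 u \<and> Q2 u) / pr Q2" for Q1 Q2
    by (simp add: cond_prob_def pr_def)
  have prob: "\<P>(u in measure_pmf P. Q u) = pr Q" for Q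
    by (simp add: pr_def)
  let ?x = "\<lambda>u. solution M u X" and ?y = "counterfactual M X x Y"
  let ?e = "obs M E" and ?z = "obs M Z"
  have product: "pr (\<lambda>u. ?x u = a \<and> ?y u = b \<and> (?e u, ?z u) = c) * pr (\<lambda>u. (?e u, ?z u) = c) =
      pr (\<lambda>u. ?x u = a \<and> (?e u, ?z u) = c) * pr (\<lambda>u. ?y u = b \<and> (?e u, ?z u) = c)" for a b c
    unfolding pr_def
  proof (rule prob_counterfactual_product[OF assms(2,5,3,4,9)])
    have restrict_eq: "restrict f W = restrict g W \<longleftrightarrow> (\<forall>i\<in>W. f i = g i)" for f g :: "'v \<Rightarrow> 'a" and W
      by (metis restrict_apply' restrict_ext)
    show "(?e u, ?z u) = (?e u', ?z u') \<longleftrightarrow> (\<forall>i\<in>E \<union> Z. solution M u i = solution M u' i)" for u u'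
      by (auto simp: obs_def restrict_eq)
  qed
  have indep: "cond_indep P ?x ?y (\<lambda>u. (?e u, ?z u))"
    unfolding cond_indep_def cond prob conj_assoc
  proof (intro allI impI)
    fix a b c assume "0 < pr (\<lambda>u. (?e u, ?z u) = c)"
    then show "pr (\<lambda>u. ?x u = a \<and> ?y u = b \<and> (?e u, ?z u) = c) / pr (\<lambda>u. (?e u, ?z u) = c) =
        pr (\<lambda>u. ?x u = a \<and> (?e u, ?z u) = c) / pr (\<lambda>u. (?e u, ?z u) = c) *
        (pr (\<lambda>u. ?y u = b \<and> (?e u, ?z u) = c) / pr (\<lambda>u. (?e u, ?z u) = c))"
      using product[of a b c] by (simp add: field_simps)
  qed
  have formula: "pr (\<lambda>u. ?y u = y \<and> ?e u = e) / pr (\<lambda>u. ?e u = e) =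
      (\<Sum>z\<in>{z \<in> PiE Z (val M). 0 < pr (\<lambda>u. ?z u = z \<and> ?e u = e) / pr (\<lambda>u. ?e u = e)}.
        pr (\<lambda>u. solution M u Y = y \<and> ?z u = z \<and> ?x u = x \<and> ?e u = e) /
          pr (\<lambda>u. ?z u = z \<and> ?x u = x \<and> ?e u = e) *
        (pr (\<lambda>u. ?z u = z \<and> ?e u = e) / pr (\<lambda>u. ?e u = e)))"
    if e: "0 < pr (\<lambda>u. ?e u = e)"
      and pos: "\<forall>z\<in>PiE Z (val M). 0 < pr (\<lambda>u. ?z u = z \<and> ?e u = e) \<longrightarrow>
                  0 < pr (\<lambda>u. ?z u = z \<and> ?x u = x \<and> ?e u = e)" for y
  proof -
    let ?I = "{z \<in> PiE Z (val M). 0 < pr (\<lambda>u. ?z u = z \<and> ?e u = e) / pr (\<lambda>u. ?e u = e)}"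
    have fin: "finite (PiE Z (val M))"
      using assms(7) finite_endo finite_val by (intro finite_PiE) (auto intro: finite_subset)
    have consistent: "?y u = solution M u Y" if "?x u = x" for u
      using solution_intervene_consistent[OF assms(2,5) that] by (simp add: counterfactual_def)
    \<comment> \<open>Where \<open>X = x\<close>, consistency replaces \<open>Y\<close> by its
      counterfactual. Then \<open>product\<close> drops the condition \<open>X = x\<close>, and the
      joint probability of \<open>z\<close> and \<open>e\<close> cancels.\<close>
    have summand: "pr (\<lambda>u. solution M u Y = y \<and> ?z u = z \<and> ?x u = x \<and> ?e u = e) /
          pr (\<lambda>u. ?z u = z \<and> ?x u = x \<and> ?e u = e) *
        (pr (\<lambda>u. ?z u = z \<and> ?e u = e) / pr (\<lambda>u. ?e u = e)) =
        pr (\<lambda>u. (?y u = y \<and> ?e u = e) \<and> ?z u = z) / pr (\<lambda>u. ?e u = e)"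
      if z: "z \<in> ?I" for z
    proof -
      have "0 < pr (\<lambda>u. ?z u = z \<and> ?x u = x \<and> ?e u = e)"
        using z e pos by (simp add: zero_less_divide_iff)
      moreover have "(\<lambda>u. solution M u Y = y \<and> ?z u = z \<and> ?x u = x \<and> ?e u = e) =
          (\<lambda>u. ?x u = x \<and> ?y u = y \<and> (?e u, ?z u) = (e, z))"
        using consistent by (auto simp: fun_eq_iff)
      moreover have "(\<lambda>u. ?z u = z \<and> ?x u = x \<and> ?e u = e) = (\<lambda>u. ?x u = x \<and> (?e u, ?z u) = (e, z))"
        "(\<lambda>u. ?z u = z \<and> ?e u = e) = (\<lambda>u. (?e u, ?z u) = (e, z))"
        "(\<lambda>u. (?y u = y \<and> ?e u = e) \<and> ?z u = z) = (\<lambda>u. ?y u = y \<and> (?e u, ?z u) = (e, z))"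
        by (auto simp: fun_eq_iff)
      ultimately show ?thesis
        using product[of x y "(e, z)"] by (simp add: field_simps)
    qed
    \<comment> \<open>Values \<open>z\<close> outside \<open>?I\<close> have joint probability zero
      with \<open>e\<close>, so total probability may be restricted to \<open>?I\<close>.\<close>
    have null: "pr (\<lambda>u. (?y u = y \<and> ?e u = e) \<and> ?z u = z) = 0"
      if "z \<in> PiE Z (val M) - ?I" for z
    proof -
      have "pr (\<lambda>u. (?y u = y \<and> ?e u = e) \<and> ?z u = z) \<le> pr (\<lambda>u. ?z u = z \<and> ?e u = e)"
        unfolding pr_def by (rule measure_pmf.finite_measure_mono) auto
      also have "\<dots> \<le> 0" using that e by (auto simp: zero_less_divide_iff)
      finally show ?thesis by (simp add: pr_def measure_le_0_iff)
    qed
    have "pr (\<lambda>u. ?y u = y \<and> ?e u = e) =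
          (\<Sum>z\<in>PiE Z (val M). pr (\<lambda>u. (?y u = y \<and> ?e u = e) \<and> ?z u = z))"
      unfolding pr_def by (rule prob_total_obs[OF assms(7), symmetric])
    also have "\<dots> = (\<Sum>z\<in>?I. pr (\<lambda>u. (?y u = y \<and> ?e u = e) \<and> ?z u = z))"
      using fin null by (intro sum.mono_neutral_right) auto
    finally have split: "pr (\<lambda>u. ?y u = y \<and> ?e u = e) =
        (\<Sum>z\<in>?I. pr (\<lambda>u. (?y u = y \<and> ?e u = e) \<and> ?z u = z))" .
    show ?thesis
      unfolding split sum_divide_distrib by (rule sum.cong[OF refl summand[symmetric]])
  qed
  show ?thesis
    unfolding cond prob using indep formula by blast
qed

end
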